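(* For any two disjoint sets of (declared) procedures $P^+_1$ and $P^+_2$, abstracted individually into components $m_1$ and $m_2$, respectively, and with $P^+_1\cup P^+_2$ abstracted into component $m$, it holds that $m_1\times m_2=m$.
   Context: Language. Let $\mathcal{P}$ be a finite set of procedure names. Statements are given by $S::=\mathsf{skip}\mid x:=a\mid S_1;S_2\mid\mathsf{if}\ b\ \mathsf{then}\ S_1\ \mathsf{else}\ S_2\mid\mathsf{while}\ b\ \mathsf{do}\ S\mid\mathsf{call}\ p$ with $p\in\mathcal{P}$, $a$ arithmetic and $b$ Boolean expressions over the (global, integer-valued) program variables. Declared procedures have declarations $\mathsf{proc}\ p\ \mathsf{is}\ S_p$. A procedure $p$ calls $p'$ if $\mathsf{call}\ p'$ occurs in $S_p$. $\mathbf{State}$ is the set of mappings from program variables to integers. Environments. For $P\subseteq\mathcal{P}$, $\mathbf{Env}_P$ is the set of functions $P\to 2^{\mathbf{State}\times\mathbf{State}}$. For $\rho\in\mathbf{Env}_P$, $\rho'\in\mathbf{Env}_{P'}$, $\rho\sqsubseteq\rho'$ iff $P\subseteq P'$ and $\rho(p)\subseteq\rho'(p)$ for all $p\in P$. An interface is a pair $(P^-,P^+)$ of disjoint sets of procedure names (required: called but not declared; provided: declared). Denotations. For an interface $(P^-,P^+)$, $\rho^-\in\mathbf{Env}_{P^-}$ and $\rho^+\in\mathbf{Env}_{P^+}$, the denotation $[\![S]\!]^{\rho^+}_{\rho^-}\subseteq\mathbf{State}\times\mathbf{State}$ is the standard relational one, by induction on $S$: $\mathsf{skip}$ denotes the identity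 relation; $x:=a$ denotes $\{(s,s[x\mapsto a(s)])\}$, where $a(s)$ is the value of $a$ in $s$; $S_1;S_2$ denotes the relational composition (first $S_1$, then $S_2$); the conditional denotes the union of the denotation of $S_1$ restricted to initial states satisfying $b$ and that of $S_2$ restricted to initial states not satisfying $b$; $\mathsf{while}\ b\ \mathsf{do}\ S$ denotes the least relation $R$ such that $R=\{(s,s)\mid s\not\models b\}\cup\{(s,s'')\mid s\models b,\ \exists s'.\,(s,s')\in[\![S]\!]^{\rho^+}_{\rho^-},(s',s'')\in R\}$; and $[\![\mathsf{call}\ p]\!]^{\rho^+}_{\rho^-}$ is $\rho^-(p)$ if $p\in P^-$ and $\rho^+(p)$ if $p\in P^+$. Given $\rho^-\in\mathbf{Env}_{P^-}$, let $\xi:\mathbf{Env}_{P^+}\to\mathbf{Env}_{P^+}$ be $\xi(\rho^+)(p)=[\![S_p]\!]^{\rho^+}_{\rho^-}$ for $p\in P^+$; it is monotonic, and $\rho^+_0$ denotes its least fixed point. The standard denotation of $S$ in the context of $(P^-,P^+)$ and $\rho^-$ is $[\![S]\!]_{\rho^-}:=[\![S]\!]^{\rho^+_0}_{\rho^-}$. Components. A component $m$ with interface $(P^-_m,P^+_m)$ is a mapping $m:\mathbf{Env}_{P^-_m}\to\mathbf{Env}_{P^+_m}$ (monotonic w.r.t. $\sqsubseteq$). Components $m_1,m_2$ are composable iff $P^+_{m_1}\cap P^+_{m_2}=\varnothing$; then $m_1\times m_2$ has $P^+_{m_1\times m_2}=P^+_{m_1}\cup P^+_{m_2}$, $P^-_{m_1\times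 m_2}=(P^-_{m_1}\cup P^-_{m_2})\setminus(P^+_{m_1}\cup P^+_{m_2})$, and for $\rho^-\in\mathbf{Env}_{P^-_{m_1\times m_2}}$, $(m_1\times m_2)(\rho^-)$ is the least fixed point of $\chi^+:\mathbf{Env}_{P^+_{m_1\times m_2}}\to\mathbf{Env}_{P^+_{m_1\times m_2}}$ given by $\chi^+(\rho^+)(p)=m_1(\rho^-_{m_1})(p)$ for $p\in P^+_{m_1}$ and $m_2(\rho^-_{m_2})(p)$ for $p\in P^+_{m_2}$, where $\rho^-_{m_1}\in\mathbf{Env}_{P^-_{m_1}}$ is $\rho^-_{m_1}(p)=\rho^+(p)$ if $p\in P^-_{m_1}\cap P^+_{m_2}$ and $\rho^-(p)$ if $p\in P^-_{m_1}\setminus P^+_{m_2}$, and $\rho^-_{m_2}$ is defined symmetrically. Abstraction of procedure sets into components. A set $P^+$ of declared procedures, whose set of called procedures is $P'$, is abstracted into the component $m:\mathbf{Env}_{P^-_m}\to\mathbf{Env}_{P^+_m}$ with $P^+_m:=P^+$, $P^-_m:=P'\setminus P^+_m$, and $m(\rho^-_m)(p):=[\![S_p]\!]_{\rho^-_m}$ for all $\rho^-_m\in\mathbf{Env}_{P^-_m}$ and $p\in P^+_m$, the standard denotation being taken in the context of the interface $(P^-_m,P^+_m)$. *)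

theory Defs
  imports Main "HOL-Library.FuncSet"
begin

text \<open>
  Arithmetic and Boolean expressions are left abstract: their syntax is given by the types
  \<open>'a\<close> and \<open>'b\<close>, and their meaning by evaluation functions \<open>aval\<close> and \<open>bval\<close>, which are
  parameters of everything below. Program variables are the elements of \<open>'x\<close>, procedure names
  those of \<open>'p\<close>.
\<close>

type_synonym 'x state = "'x \<Rightarrow> int"
type_synonym 'x srel = "('x state \<times> 'x state) set"

datatype ('x, 'a, 'b, 'p) stmt =
    Skip
  | Assign 'x 'a
  | Seq "('x, 'a, 'b, 'p) stmt" "('x, 'a, 'b, 'p) stmt"
  | Cond 'b "('x, 'a, 'b, 'p) stmt" "('x, 'a, 'b, 'p) stmt"
  | While 'b "('x, 'a, 'b, 'p) stmt"
  | Call 'p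

primrec calls :: "('x, 'a, 'b, 'p) stmt \<Rightarrow> 'p set" where
  "calls Skip = {}"
| "calls (Assign x a) = {}"
| "calls (Seq S1 S2) = calls S1 \<union> calls S2"
| "calls (Cond b S1 S2) = calls S1 \<union> calls S2"
| "calls (While b S) = calls S"
| "calls (Call p) = {p}"

text \<open>
  A function from \<open>P\<close> to state relations is represented by the total function that extends it by
  the empty relation outside \<open>P\<close>. The order on \<open>Env P\<close> is then the library's pointwise inclusion
  \<open>\<le>\<close>. A function mapping all of \<open>'p \<Rightarrow> 'x srel\<close> monotonically into \<open>Env P\<close> has all its fixed
  points in \<open>Env P\<close>, so that its \<open>lfp\<close> is also its least fixed point on \<open>Env P\<close>.
\<close>

type_synonym ('x, 'p) env = "'p \<Rightarrow> 'x srel"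

definition Env :: "'p set \<Rightarrow> ('x, 'p) env set" where
  "Env P = {\<rho>. \<forall>p. p \<notin> P \<longrightarrow> \<rho> p = {}}"

text \<open>
  Denotation of a statement for the interface \<open>(Pm, Pp)\<close> (required, provided) and environments
  \<open>\<rho>m \<in> Env Pm\<close> and \<open>\<rho>p \<in> Env Pp\<close>. The value \<open>{}\<close> for calls to procedures outside the
  interface is a dummy.
\<close>

primrec den ::
  "('a \<Rightarrow> 'x state \<Rightarrow> int) \<Rightarrow> ('b \<Rightarrow> 'x state \<Rightarrow> bool) \<Rightarrow> 'p set \<Rightarrow> 'p set \<Rightarrow>
   ('x, 'p) env \<Rightarrow> ('x, 'p) env \<Rightarrow> ('x, 'a, 'b, 'p) stmt \<Rightarrow> 'x srel" where
  "den aval bval Pm Pp \<rho>m \<rho>p Skip = Id"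
| "den aval bval Pm Pp \<rho>m \<rho>p (Assign x a) = {(s, s(x := aval a s)) | s. True}"
| "den aval bval Pm Pp \<rho>m \<rho>p (Seq S1 S2) =
     den aval bval Pm Pp \<rho>m \<rho>p S1 O den aval bval Pm Pp \<rho>m \<rho>p S2"
| "den aval bval Pm Pp \<rho>m \<rho>p (Cond b S1 S2) =
     {(s, s'). bval b s \<and> (s, s') \<in> den aval bval Pm Pp \<rho>m \<rho>p S1} \<union>
     {(s, s'). \<not> bval b s \<and> (s, s') \<in> den aval bval Pm Pp \<rho>m \<rho>p S2}"
| "den aval bval Pm Pp \<rho>m \<rho>p (While b S) =
     lfp (\<lambda>R. {(s, s) | s. \<not> bval b s} \<union>
              {(s, s''). bval b s \<and>
                 (\<exists>s'. (s, s') \<in> den aval bval Pm Pp \<rho>m \<rho>p S \<and> (s', s'') \<in> R)})"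
| "den aval bval Pm Pp \<rho>m \<rho>p (Call p) =
     (if p \<in> Pm then \<rho>m p else if p \<in> Pp then \<rho>p p else {})"

text \<open>
  Here \<open>body p\<close> is the body of the declaration of \<open>p\<close>; it only matters for declared procedures.
\<close>

definition xi ::
  "('a \<Rightarrow> 'x state \<Rightarrow> int) \<Rightarrow> ('b \<Rightarrow> 'x state \<Rightarrow> bool) \<Rightarrow> ('p \<Rightarrow> ('x, 'a, 'b, 'p) stmt) \<Rightarrow>
   'p set \<Rightarrow> 'p set \<Rightarrow> ('x, 'p) env \<Rightarrow> ('x, 'p) env \<Rightarrow> ('x, 'p) env" where
  "xi aval bval body Pm Pp \<rho>m \<rho>p =
     (\<lambda>p. if p \<in> Pp then den aval bval Pm Pp \<rho>m \<rho>p (body p) else {})"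

definition std_den ::
  "('a \<Rightarrow> 'x state \<Rightarrow> int) \<Rightarrow> ('b \<Rightarrow> 'x state \<Rightarrow> bool) \<Rightarrow> ('p \<Rightarrow> ('x, 'a, 'b, 'p) stmt) \<Rightarrow>
   'p set \<Rightarrow> 'p set \<Rightarrow> ('x, 'p) env \<Rightarrow> ('x, 'a, 'b, 'p) stmt \<Rightarrow> 'x srel" where
  "std_den aval bval body Pm Pp \<rho>m S =
     den aval bval Pm Pp \<rho>m (lfp (xi aval bval body Pm Pp \<rho>m)) S"

text \<open>
  The mapping of a component is made extensional, i.e. \<open>undefined\<close> outside \<open>Env (req m)\<close>, so that
  equality of components is equality of interfaces and of mappings on \<open>Env (req m)\<close>.
\<close>

record ('x, 'p) component =
  req :: "'p set"
  prov :: "'p set"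
  sem :: "('x, 'p) env \<Rightarrow> ('x, 'p) env"

definition is_component :: "('x, 'p) component \<Rightarrow> bool" where
  "is_component m \<longleftrightarrow>
     req m \<inter> prov m = {} \<and>
     sem m \<in> Env (req m) \<rightarrow>\<^sub>E Env (prov m) \<and>
     mono_on (Env (req m)) (sem m)"

definition composable :: "('x, 'p) component \<Rightarrow> ('x, 'p) component \<Rightarrow> bool" where
  "composable m1 m2 \<longleftrightarrow> prov m1 \<inter> prov m2 = {}"

text \<open>
  \<open>arg_env m m' \<rho>m \<rho>p\<close> is the environment passed to \<open>m\<close> when it is composed with \<open>m'\<close>.
\<close>

definition arg_env ::
  "('x, 'p) component \<Rightarrow> ('x, 'p) component \<Rightarrow> ('x, 'p) env \<Rightarrow> ('x, 'p) env \<Rightarrow> ('x, 'p) env" where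
  "arg_env m m' \<rho>m \<rho>p =
     (\<lambda>p. if p \<in> req m \<inter> prov m' then \<rho>p p
          else if p \<in> req m - prov m' then \<rho>m p
          else {})"

definition chi ::
  "('x, 'p) component \<Rightarrow> ('x, 'p) component \<Rightarrow> ('x, 'p) env \<Rightarrow> ('x, 'p) env \<Rightarrow> ('x, 'p) env" where
  "chi m1 m2 \<rho>m \<rho>p =
     (\<lambda>p. if p \<in> prov m1 then sem m1 (arg_env m1 m2 \<rho>m \<rho>p) p
          else if p \<in> prov m2 then sem m2 (arg_env m2 m1 \<rho>m \<rho>p) p
          else {})"

text \<open>Only meaningful if \<open>composable m1 m2\<close>.\<close>

definition comp_prod ::
  "('x, 'p) component \<Rightarrow> ('x, 'p) component \<Rightarrow> ('x, 'p) component" (infixl \<open>\<otimes>\<^sub>c\<close> 70) where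
  "m1 \<otimes>\<^sub>c m2 =
     (let Pp = prov m1 \<union> prov m2;
          Pm = (req m1 \<union> req m2) - (prov m1 \<union> prov m2)
      in \<lparr>req = Pm, prov = Pp, sem = (\<lambda>\<rho>m \<in> Env Pm. lfp (chi m1 m2 \<rho>m))\<rparr>)"

definition abstraction ::
  "('a \<Rightarrow> 'x state \<Rightarrow> int) \<Rightarrow> ('b \<Rightarrow> 'x state \<Rightarrow> bool) \<Rightarrow> ('p \<Rightarrow> ('x, 'a, 'b, 'p) stmt) \<Rightarrow>
   'p set \<Rightarrow> ('x, 'p) component" where
  "abstraction aval bval body Pp =
     (let Pm = (\<Union>p\<in>Pp. calls (body p)) - Pp
      in \<lparr>req = Pm, prov = Pp,
          sem = (\<lambda>\<rho>m \<in> Env Pm. \<lambda>p. if p \<in> Pp then std_den aval bval body Pm Pp \<rho>m (body p) else {})\<rparr>)"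


text \<open>
  The operators above are monotonic, so the least fixed points exist, and the abstraction of a
  set of procedures is a component.
\<close>

lemma den_mono:
  assumes "\<rho>m \<le> \<rho>m'" "\<rho>p \<le> \<rho>p'"
  shows "den aval bval Pm Pp \<rho>m \<rho>p S \<subseteq> den aval bval Pm Pp \<rho>m' \<rho>p' S"
proof (induction S)
  case (Seq S1 S2)
  then show ?case unfolding den.simps by (rule relcomp_mono)
next
  case (While b S)
  show ?case unfolding den.simps
    by (rule lfp_mono) (use While in blast)
next
  case (Call p)
  have "\<rho>m p \<subseteq> \<rho>m' p" "\<rho>p p \<subseteq> \<rho>p' p" using assms by (auto simp: le_fun_def)
  then show ?case by simp
next
  case (Cond b S1 S2)
  then show ?case unfolding den.simps by blast
qed simp_all

lemma xi_mono:
  assumes "\<rho>m \<le> \<rho>m'" "\<rho>p \<le> \<rho>p'"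
  shows "xi aval bval body Pm Pp \<rho>m \<rho>p \<le> xi aval bval body Pm Pp \<rho>m' \<rho>p'"
  by (simp add: xi_def le_fun_def den_mono[OF assms])

lemma mono_xi: "mono (xi aval bval body Pm Pp \<rho>m)"
  by (intro monoI xi_mono order_refl)

lemma arg_env_in_Env: "arg_env m m' \<rho>m \<rho>p \<in> Env (req m)"
  by (auto simp: arg_env_def Env_def)

lemma mono_chi:
  assumes "is_component m1" "is_component m2"
  shows "mono (chi m1 m2 \<rho>m)"
proof (rule monoI)
  fix \<rho> \<rho>' :: "('a, 'b) env" assume le: "\<rho> \<le> \<rho>'"
  have "sem m (arg_env m m' \<rho>m \<rho>) \<le> sem m (arg_env m m' \<rho>m \<rho>')" if "is_component m" for m m'
  proof -
    have "arg_env m m' \<rho>m \<rho> \<le> arg_env m m' \<rho>m \<rho>'"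
      using le by (auto simp: arg_env_def le_fun_def)
    then show ?thesis using that arg_env_in_Env
      by (auto simp: is_component_def dest!: mono_onD)
  qed
  from this[OF assms(1)] this[OF assms(2)]
  show "chi m1 m2 \<rho>m \<rho> \<le> chi m1 m2 \<rho>m \<rho>'"
    by (auto simp: chi_def le_fun_def)
qed

lemma abstraction_is_component: "is_component (abstraction aval bval body P)"
proof -
  define Pm where "Pm = (\<Union>p\<in>P. calls (body p)) - P"
  have "std_den aval bval body Pm P \<rho> S \<subseteq> std_den aval bval body Pm P \<rho>' S"
    if "\<rho> \<le> \<rho>'" for \<rho> \<rho>' S
    unfolding std_den_def using that
    by (intro den_mono lfp_mono xi_mono order_refl) auto
  then show ?thesis
    by (auto simp: is_component_def abstraction_def Let_def Pm_def[symmetric] Env_def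
        le_fun_def intro!: mono_onI) (auto simp: Pm_def)
qed

lemma comp_prod_is_component:
  assumes m1: "is_component m1" and m2: "is_component m2"
  shows "is_component (m1 \<otimes>\<^sub>c m2)"
proof -
  have le: "sem m (arg_env m m' \<rho> \<sigma>) \<le> sem m (arg_env m m' \<rho>' \<sigma>)"
    if "\<rho> \<le> \<rho>'" "is_component m" for \<rho> \<rho>' \<sigma> and m m' :: "('a, 'b) component"
  proof -
    have "arg_env m m' \<rho> \<sigma> \<le> arg_env m m' \<rho>' \<sigma>"
      using that(1) by (simp add: arg_env_def le_fun_def)
    then show ?thesis
      using that(2) arg_env_in_Env unfolding is_component_def by (blast dest: mono_onD)
  qed
  have "lfp (chi m1 m2 \<rho>) \<le> lfp (chi m1 m2 \<rho>')" if "\<rho> \<le> \<rho>'" for \<rho> \<rho>'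
    using le[OF that m1] le[OF that m2] by (intro lfp_mono) (simp add: chi_def le_fun_def)
  moreover have "lfp (chi m1 m2 \<rho>) \<in> Env (prov m1 \<union> prov m2)" for \<rho>
    by (subst lfp_unfold[OF mono_chi[OF m1 m2]]) (simp add: chi_def Env_def)
  ultimately show ?thesis
    by (auto simp: is_component_def comp_prod_def Let_def intro!: mono_onI)
qed

end

theory Submission
  imports Defs
begin

text \<open>
  This is an instance of Bekic's principle. A component abstracted from a set of procedures maps
  \<open>\<rho>\<close> to the least fixed point of \<open>xi\<close>, so the product is a nested least fixed point: an outer one
  over \<open>P1 \<union> P2\<close>, with inner ones over \<open>P1\<close> and over \<open>P2\<close> in which the environment of the other
  set is held constant. For a body in \<open>P1\<close>, the inner \<open>xi\<close> and the \<open>xi\<close> of \<open>P1 \<union> P2\<close> agree as soon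
  as the environments agree on the procedures called. Hence the nested fixed point is a fixed point
  of the joint \<open>xi\<close>, and conversely the joint one is a prefixed point of \<open>chi\<close>.
\<close>

text \<open>Agreement is phrased through \<open>Call p\<close> because the interfaces may differ
  too: a procedure required on one side may be provided on the other.\<close>

lemma den_cong:
  assumes "\<And>p. p \<in> calls S \<Longrightarrow>
    den aval bval Pm Pp \<rho>m \<rho>p (Call p) = den aval bval Qm Qp \<sigma>m \<sigma>p (Call p)"
  shows "den aval bval Pm Pp \<rho>m \<rho>p S = den aval bval Qm Qp \<sigma>m \<sigma>p S"
  using assms by (induction S) (simp_all del: den.simps(6) add: den.simps(1-5))

lemma req_abstraction: "req (abstraction aval bval body P) = (\<Union>p\<in>P. calls (body p)) - P"
  by (simp add: abstraction_def Let_def)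

lemma prov_abstraction: "prov (abstraction aval bval body P) = P"
  by (simp add: abstraction_def Let_def)

text \<open>Evaluating every body of \<open>P\<close> at the least fixed point is one more
  application of \<open>xi\<close>, which leaves that point unchanged.\<close>

lemma sem_abstraction:
  fixes aval bval body P
  defines "m \<equiv> abstraction aval bval body P"
  assumes "\<rho> \<in> Env (req m)"
  shows "sem m \<rho> = lfp (xi aval bval body (req m) P \<rho>)"
proof -
  have "sem m \<rho> = xi aval bval body (req m) P \<rho> (lfp (xi aval bval body (req m) P \<rho>))"
    using assms(2) unfolding m_def
    by (intro ext) (simp add: abstraction_def Let_def xi_def std_den_def)
  then show ?thesis
    by (simp add: lfp_fixpoint[OF mono_xi])
qed

text \<open>A call from a body in \<open>P\<close> reads \<open>\<tau>\<close> inside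
  \<open>P\<close>, \<open>\<sigma>\<close> (through \<open>arg_env\<close>) in the rest of
  \<open>Q\<close>, and \<open>\<rho>\<close> elsewhere. \<open>\<tau>\<close> is separate from
  \<open>\<sigma>\<close> so that it can be either the outer environment or the inner least fixed
  point.\<close>

lemma xi_arg_env:
  fixes aval bval body P Q
  defines "m \<equiv> abstraction aval bval body P"
    and "m' \<equiv> abstraction aval bval body Q"
    and "n \<equiv> abstraction aval bval body (P \<union> Q)"
  assumes "p \<in> P" "\<And>q. q \<in> P \<Longrightarrow> \<tau> q = \<sigma> q"
  shows "xi aval bval body (req m) P (arg_env m m' \<rho> \<sigma>) \<tau> p =
    xi aval bval body (req n) (P \<union> Q) \<rho> \<sigma> p"
proof -
  have "den aval bval (req m) P (arg_env m m' \<rho> \<sigma>) \<tau> (body p) =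
    den aval bval (req n) (P \<union> Q) \<rho> \<sigma> (body p)"
    by (rule den_cong)
      (use assms(4,5) in \<open>auto simp: m_def m'_def n_def req_abstraction prov_abstraction arg_env_def\<close>)
  then show ?thesis
    using assms(4) by (simp add: xi_def)
qed

text \<open>\<open>X\<close> is a prefixed point of the inner \<open>xi\<close>: on \<open>P\<close>
  the inner step agrees with the joint one, which fixes \<open>X\<close>, and outside
  \<open>P\<close> it gives the empty relation.\<close>

lemma sem_abstraction_le:
  fixes aval bval body P Q \<rho>
  defines "m \<equiv> abstraction aval bval body P"
    and "m' \<equiv> abstraction aval bval body Q"
    and "n \<equiv> abstraction aval bval body (P \<union> Q)"
  defines "X \<equiv> lfp (xi aval bval body (req n) (P \<union> Q) \<rho>)"
  shows "sem m (arg_env m m' \<rho> X) \<le> X"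
proof -
  let ?xi = "xi aval bval body (req m) P (arg_env m m' \<rho> X)"
  have "?xi X p \<le> X p" for p
  proof (cases "p \<in> P")
    case True
    then have "?xi X p = xi aval bval body (req n) (P \<union> Q) \<rho> X p"
      unfolding m_def m'_def n_def by (rule xi_arg_env) simp
    also have "\<dots> = X p"
      unfolding X_def by (simp add: lfp_fixpoint[OF mono_xi])
    finally show ?thesis by simp
  qed (simp add: xi_def)
  then have "lfp ?xi \<le> X"
    by (intro lfp_lowerbound le_funI)
  \<comment> \<open>\<open>arg_env\<close> always lies in \<open>Env (req m)\<close>, where the
    extensional \<open>sem m\<close> is the least fixed point.\<close>
  then show ?thesis
    using arg_env_in_Env[of m m' \<rho> X] by (simp add: m_def sem_abstraction)
qed

lemma sem_abstraction_eq_xi: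
  fixes aval bval body P Q
  defines "m \<equiv> abstraction aval bval body P"
    and "m' \<equiv> abstraction aval bval body Q"
    and "n \<equiv> abstraction aval bval body (P \<union> Q)"
  assumes "p \<in> P" and eq: "\<And>q. q \<in> P \<Longrightarrow> sem m (arg_env m m' \<rho> Y) q = Y q"
  shows "xi aval bval body (req n) (P \<union> Q) \<rho> Y p = Y p"
proof -
  let ?xi = "xi aval bval body (req m) P (arg_env m m' \<rho> Y)"
  have sem: "sem m (arg_env m m' \<rho> Y) = lfp ?xi"
    using arg_env_in_Env[of m m' \<rho> Y] by (simp add: m_def sem_abstraction)
  \<comment> \<open>Here \<open>\<tau>\<close> is the inner least fixed point, which agrees with
    \<open>Y\<close> on \<open>P\<close> by \<open>eq\<close>.\<close>
  have "?xi (lfp ?xi) p = xi aval bval body (req n) (P \<union> Q) \<rho> Y p"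
    using \<open>p \<in> P\<close> eq unfolding sem unfolding m_def m'_def n_def by (rule xi_arg_env)
  then show ?thesis
    using eq[OF \<open>p \<in> P\<close>] by (simp add: sem lfp_fixpoint[OF mono_xi])
qed

lemma lfp_chi_abstraction:
  fixes aval bval body P1 P2 \<rho>
  defines "m1 \<equiv> abstraction aval bval body P1"
    and "m2 \<equiv> abstraction aval bval body P2"
    and "n \<equiv> abstraction aval bval body (P1 \<union> P2)"
  assumes disj: "P1 \<inter> P2 = {}"
  shows "lfp (chi m1 m2 \<rho>) = lfp (xi aval bval body (req n) (P1 \<union> P2) \<rho>)"
    (is "?Y = ?X")
proof (rule antisym)
  have "sem m1 (arg_env m1 m2 \<rho> ?X) \<le> ?X"
    unfolding m1_def m2_def n_def by (rule sem_abstraction_le)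
  moreover have "sem m2 (arg_env m2 m1 \<rho> ?X) \<le> ?X"
    unfolding m1_def m2_def n_def Un_commute[of P1] by (rule sem_abstraction_le)
  ultimately show "?Y \<le> ?X"
    by (intro lfp_lowerbound) (simp add: chi_def le_fun_def)
next
  have "mono (chi m1 m2 \<rho>)"
    unfolding m1_def m2_def by (intro mono_chi abstraction_is_component)
  then have Y: "chi m1 m2 \<rho> ?Y p = ?Y p" for p
    by (metis lfp_unfold)
  have Y1: "sem m1 (arg_env m1 m2 \<rho> ?Y) p = ?Y p" if "p \<in> P1" for p
    using Y[of p] that unfolding chi_def m1_def prov_abstraction by simp
  have Y2: "sem m2 (arg_env m2 m1 \<rho> ?Y) p = ?Y p" if "p \<in> P2" for p
  proof -
    \<comment> \<open>\<open>chi\<close> tests \<open>prov m1\<close> first, so disjointness is what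
      leads it to \<open>m2\<close>.\<close>
    have "p \<notin> P1" using that disj by blast
    then show ?thesis
      using Y[of p] that unfolding chi_def m1_def m2_def prov_abstraction by simp
  qed
  have "xi aval bval body (req n) (P1 \<union> P2) \<rho> ?Y p \<le> ?Y p" for p
  proof -
    consider "p \<in> P1" | "p \<in> P2" | "p \<notin> P1 \<union> P2" by blast
    then show ?thesis
    proof cases
      case 1
      then have "xi aval bval body (req n) (P1 \<union> P2) \<rho> ?Y p = ?Y p"
        using Y1 unfolding m1_def m2_def n_def by (rule sem_abstraction_eq_xi)
      then show ?thesis by simp
    next
      case 2
      then have "xi aval bval body (req n) (P1 \<union> P2) \<rho> ?Y p = ?Y p"
        using Y2 unfolding m1_def m2_def n_def Un_commute[of P1] by (rule sem_abstraction_eq_xi)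
      then show ?thesis by simp
    qed (simp add: xi_def)
  qed
  then show "?X \<le> ?Y"
    by (intro lfp_lowerbound le_funI)
qed

theorem theorem4:
  fixes aval :: "'a \<Rightarrow> 'x state \<Rightarrow> int"
    and bval :: "'b \<Rightarrow> 'x state \<Rightarrow> bool"
    and body :: "'p::finite \<Rightarrow> ('x, 'a, 'b, 'p) stmt"
    and P1 P2 :: "'p set"
  assumes "P1 \<inter> P2 = {}"
  shows "abstraction aval bval body P1 \<otimes>\<^sub>c abstraction aval bval body P2
       = abstraction aval bval body (P1 \<union> P2)"
proof -
  let ?m1 = "abstraction aval bval body P1" and ?m2 = "abstraction aval bval body P2"
    and ?n = "abstraction aval bval body (P1 \<union> P2)"
  have req: "req ?m1 \<union> req ?m2 - (P1 \<union> P2) = req ?n"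
    by (auto simp: req_abstraction)
  have "lfp (chi ?m1 ?m2 \<rho>) = sem ?n \<rho>" if "\<rho> \<in> Env (req ?n)" for \<rho>
    using that by (simp add: lfp_chi_abstraction[OF assms] sem_abstraction)
  \<comment> \<open>Both mappings are \<open>undefined\<close> outside \<open>Env (req ?n)\<close>,
    so agreement on that set gives equality of the record fields.\<close>
  moreover have "sem ?n \<in> extensional (Env (req ?n))"
    by (simp add: abstraction_def Let_def)
  ultimately have "(\<lambda>\<rho>\<in>Env (req ?n). lfp (chi ?m1 ?m2 \<rho>)) = sem ?n"
    by (intro extensionalityI[of _ "Env (req ?n)"]) simp_all
  then have "?m1 \<otimes>\<^sub>c ?m2 = \<lparr>req = req ?n, prov = prov ?n, sem = sem ?n\<rparr>"
    by (simp add: comp_prod_def Let_def prov_abstraction req)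
  then show ?thesis by simp
qed

end
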